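(* Let $n\ge a+b$ and suppose that families $\mathcal F\subset\binom{[n]}{a}$, $\mathcal G\subset\binom{[n]}{b}$ are cross-intersecting. Fix an integer $j\ge1$. Then $$|\mathcal F|+|\mathcal G|\le\binom{n}{b}+\binom{n-j}{a-j}-\binom{n-j}{b}$$ holds in each of the following three cases: (1) $a<b$ and $|\mathcal F|\ge\binom{n-j}{a-j}$; (2) $a\ge b$ and $\binom{n-j}{a-j}\le|\mathcal F|\le\binom{n+b-1-a}{b-1}+\binom{n+b-2-a}{b-1}$; (3) $a\ge b$ and $\binom{n-a+b-3}{b-3}+\binom{n-a+b-4}{b-3}\le|\mathcal F|\le\binom{n-j}{a-j}$.
   Context: $[n]=\{1,\dots,n\}$, $\binom{[n]}{k}$ denotes the family of all $k$-element subsets of $[n]$. Two families $\mathcal A,\mathcal B$ are cross-intersecting if $A\cap B\ne\emptyset$ for all $A\in\mathcal A$, $B\in\mathcal B$.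
   Formalization: The family F is assumed nonempty; with binomials of negative lower entry read as 0, the claim fails for empty F, e.g. case (1) with n=4, a=1, b=2, j=2 and G all pairs (6 ≤ 5). For j ≤ a in (1),(2) and b ≥ 3 in (3), nonemptiness is automatic. *)

theory Defs
  imports "HOL-Library.Ramsey"
begin

definition cross_intersecting :: "'a set set \<Rightarrow> 'a set set \<Rightarrow> bool" where
  "cross_intersecting \<A> \<B> \<longleftrightarrow> (\<forall>A\<in>\<A>. \<forall>B\<in>\<B>. A \<inter> B \<noteq> {})"

(* Integer arguments, because the lower (and upper) entries of binomial coefficients such as
   n - j over a - j or n - a + b - 3 over b - 3 may be negative, in which case truncated
   subtraction on nat would give wrong values.  Convention: zero if either entry is negative. *)
definition ibinom :: "int \<Rightarrow> int \<Rightarrow> int" where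
  "ibinom n k = (if 0 \<le> n \<and> 0 \<le> k then int (nat n choose nat k) else 0)"

end

theory Submission
  imports Defs "HOL-Library.Nat_Bijection"
begin

text \<open>
  Put \<open>k = n - a\<close> and \<open>l = b\<close>, so that \<open>l \<le> k\<close>. A set in \<open>\<G>\<close> is not contained in the complement of a
  set in \<open>\<F>\<close>, so with \<open>H\<close> the family of these complements the task is to bound
  \<open>|\<partial>\<^sub>l H| - |H|\<close> from below by \<open>\<phi>\<^sub>k\<^sub>l(n - j)\<close>, where \<open>\<phi>\<^sub>k\<^sub>l(x) = C(x, l) - C(x, k)\<close>. By Kruskal--Katona
  (proved by Frankl's shifting argument) we may take \<open>H\<close> to be a colex initial segment. If
  \<open>C(x, k) \<le> |H| \<le> C(x + 1, k)\<close>, then \<open>H\<close> consists of all \<open>k\<close>-subsets of \<open>[x]\<close> together with a cone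
  over an initial segment \<open>H'\<close> of \<open>(k-1)\<close>-subsets of \<open>[x]\<close>, and the excess of \<open>H\<close> is at least \<open>\<phi>\<^sub>k\<^sub>l(x)\<close>
  plus the excess of \<open>H'\<close>.

  On the integers \<open>\<phi>\<^sub>k\<^sub>l\<close> increases up to \<open>k + l - 1\<close>, and there \<open>\<phi>\<^sub>k\<^sub>l(k + l - 2) = \<phi>\<^sub>k\<^sub>l(k + l - 1)\<close>.
  Normalized matching shows that a family in \<open>[x]\<close> with \<open>x \<le> k + l\<close> has nonnegative excess, and that one
  with \<open>x \<ge> k + l\<close> has excess at least \<open>\<phi>\<^sub>k\<^sub>l(x)\<close>. In case (1) because \<open>n \<le> k + l - 1\<close>,
  in case (2) by the upper bound on \<open>|\<F>|\<close>, \<open>H'\<close> lies in \<open>[k + l - 2]\<close>, where the first statement applies. In case (3) the second statement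
  settles \<open>n - j \<ge> k + l\<close>; the two remaining values of \<open>n - j\<close> have the same \<open>\<phi>\<^sub>k\<^sub>l\<close> and follow by
  decomposing once or twice.
\<close>

section \<open>Uniform families and their shadows\<close>

lemma card_nsets: "finite X \<Longrightarrow> card (nsets X k) = card X choose k"
  by (simp add: nsets_def n_subsets[symmetric])
     (metis (no_types, lifting) finite_subset)

lemma finite_family: "H \<subseteq> nsets X k \<Longrightarrow> finite X \<Longrightarrow> finite H"
  using finite_imp_finite_nsets finite_subset by blast

text \<open>The iterated shadow, passing from any level to level \<open>l\<close> in one step; the
  classical shadow of \<open>k\<close>-sets is the case \<open>l = k - 1\<close>.\<close>

definition shadow :: "nat \<Rightarrow> 'a set set \<Rightarrow> 'a set set" where
  "shadow l H = (\<Union>B\<in>H. nsets B l)"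

lemma in_shadow_iff: "A \<in> shadow l H \<longleftrightarrow> finite A \<and> card A = l \<and> (\<exists>B\<in>H. A \<subseteq> B)"
  by (auto simp: shadow_def nsets_def)

lemma shadow_subset_nsets: "H \<subseteq> nsets X k \<Longrightarrow> shadow l H \<subseteq> nsets X l"
  by (fastforce simp: in_shadow_iff nsets_def)

lemma shadow_self: "H \<subseteq> nsets X k \<Longrightarrow> shadow k H = H"
  by (auto simp: in_shadow_iff nsets_def subset_iff) (metis card_subset_eq subset_iff)

lemma finite_shadow: "finite H \<Longrightarrow> H \<subseteq> nsets X k \<Longrightarrow> finite (shadow l H)"
  unfolding shadow_def by (rule finite_UN_I) (auto simp: nsets_def intro!: finite_imp_finite_nsets[unfolded nsets_def])

lemma shadow_0: "H \<subseteq> nsets X k \<Longrightarrow> shadow 0 H = (if H = {} then {} else {{}})"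
  by (auto simp: shadow_def)

section \<open>Normalized matching\<close>

lemma card_supersets:
  assumes "finite X" "A \<in> nsets X l" "l \<le> k"
  shows "card {B \<in> nsets X k. A \<subseteq> B} = (card X - l) choose (k - l)"
proof -
  have fA: "finite A" "card A = l" "A \<subseteq> X" using assms by (auto simp: nsets_def)
  have "bij_betw (\<lambda>B. B - A) {B \<in> nsets X k. A \<subseteq> B} (nsets (X - A) (k - l))"
  proof (rule bij_betw_byWitness[where f' = "\<lambda>C. C \<union> A"])
    show "(\<lambda>B. B - A) ` {B \<in> nsets X k. A \<subseteq> B} \<subseteq> nsets (X - A) (k - l)"
      using fA by (auto simp: nsets_def card_Diff_subset)
    show "(\<lambda>C. C \<union> A) ` nsets (X - A) (k - l) \<subseteq> {B \<in> nsets X k. A \<subseteq> B}"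
    proof
      fix B assume "B \<in> (\<lambda>C. C \<union> A) ` nsets (X - A) (k - l)"
      then obtain C where C: "B = C \<union> A" "C \<subseteq> X - A" "finite C" "card C = k - l"
        by (auto simp: nsets_def)
      then have "card B = k" using fA assms(3) by (subst C(1), subst card_Un_disjoint) auto
      then show "B \<in> {B \<in> nsets X k. A \<subseteq> B}" using C fA by (auto simp: nsets_def)
    qed
  qed (auto simp: nsets_def)
  then have "card {B \<in> nsets X k. A \<subseteq> B} = card (nsets (X - A) (k - l))"
    by (rule bij_betw_same_card)
  then show ?thesis using fA assms(1) by (simp add: card_nsets card_Diff_subset)
qed

lemma card_incidences:
  assumes "finite U" "finite V"
  shows "(\<Sum>B\<in>U. card {A \<in> V. A \<subseteq> B}) = (\<Sum>A\<in>V. card {B \<in> U. A \<subseteq> B})"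
proof -
  have "(\<Sum>B\<in>U. card {A \<in> V. A \<subseteq> B}) = (\<Sum>B\<in>U. \<Sum>A\<in>V. if A \<subseteq> B then 1 else 0)"
    using assms by (intro sum.cong refl) (simp add: sum.If_cases Int_def)
  also have "\<dots> = (\<Sum>A\<in>V. \<Sum>B\<in>U. if A \<subseteq> B then 1 else 0)"
    by (rule sum.swap)
  also have "\<dots> = (\<Sum>A\<in>V. card {B \<in> U. A \<subseteq> B})"
    using assms by (intro sum.cong refl) (simp add: sum.If_cases Int_def)
  finally show ?thesis .
qed

text \<open>Double counting of the inclusions between \<open>V\<close> and \<open>U\<close>: every
  \<open>B\<close> in \<open>U\<close> contributes all of its \<open>l\<close>-subsets, and an
  \<open>A\<close> in \<open>V\<close> lies in at most as many members of \<open>U\<close> as it has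
  \<open>k\<close>-supersets in \<open>X\<close>.\<close>

lemma normalized_matching_down:
  assumes X: "finite X" and U: "U \<subseteq> nsets X k" and V: "V \<subseteq> nsets X l" and "l \<le> k"
    and sub: "\<And>B. B \<in> U \<Longrightarrow> nsets B l \<subseteq> V"
  shows "card U * (k choose l) \<le> card V * ((card X - l) choose (k - l))"
proof -
  have fin: "finite U" "finite V" using finite_family U V X by blast+
  have "card {A \<in> V. A \<subseteq> B} = k choose l" if "B \<in> U" for B
  proof -
    have "{A \<in> V. A \<subseteq> B} = nsets B l" using sub[OF that] V by (auto simp: nsets_def)
    moreover have "finite B" "card B = k" using U that by (auto simp: nsets_def)
    ultimately show ?thesis by (simp add: card_nsets)
  qed
  then have "card U * (k choose l) = (\<Sum>B\<in>U. card {A \<in> V. A \<subseteq> B})" by simp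
  also have "\<dots> = (\<Sum>A\<in>V. card {B \<in> U. A \<subseteq> B})" using fin by (rule card_incidences)
  also have "\<dots> \<le> (\<Sum>A\<in>V. (card X - l) choose (k - l))"
  proof (rule sum_mono)
    fix A assume "A \<in> V"
    then have A: "A \<in> nsets X l" using V by blast
    have "card {B \<in> U. A \<subseteq> B} \<le> card {B \<in> nsets X k. A \<subseteq> B}"
      using U X by (intro card_mono) (auto simp: finite_imp_finite_nsets)
    then show "card {B \<in> U. A \<subseteq> B} \<le> (card X - l) choose (k - l)"
      using card_supersets[OF X A \<open>l \<le> k\<close>] by simp
  qed
  finally show ?thesis by simp
qed

text \<open>The same double count in the other direction: every \<open>A\<close> in \<open>V\<close>
  contributes all of its \<open>k\<close>-supersets, and a \<open>B\<close> in \<open>U\<close> has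
  at most \<open>k choose l\<close> subsets in \<open>V\<close>.\<close>

lemma normalized_matching_up:
  assumes X: "finite X" and U: "U \<subseteq> nsets X k" and V: "V \<subseteq> nsets X l" and "l \<le> k"
    and sup: "\<And>A B. A \<in> V \<Longrightarrow> B \<in> nsets X k \<Longrightarrow> A \<subseteq> B \<Longrightarrow> B \<in> U"
  shows "card V * ((card X - l) choose (k - l)) \<le> card U * (k choose l)"
proof -
  have fin: "finite U" "finite V" using finite_family U V X by blast+
  have "card {B \<in> U. A \<subseteq> B} = (card X - l) choose (k - l)" if "A \<in> V" for A
  proof -
    have "{B \<in> U. A \<subseteq> B} = {B \<in> nsets X k. A \<subseteq> B}" using sup[OF that] U by auto
    then show ?thesis using card_supersets[OF X _ \<open>l \<le> k\<close>] V that by auto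
  qed
  then have "card V * ((card X - l) choose (k - l)) = (\<Sum>A\<in>V. card {B \<in> U. A \<subseteq> B})" by simp
  also have "\<dots> = (\<Sum>B\<in>U. card {A \<in> V. A \<subseteq> B})" using fin by (rule card_incidences[symmetric])
  also have "\<dots> \<le> (\<Sum>B\<in>U. k choose l)"
  proof (rule sum_mono)
    fix B assume "B \<in> U"
    then have B: "finite B" "card B = k" using U by (auto simp: nsets_def)
    have "card {A \<in> V. A \<subseteq> B} \<le> card (nsets B l)"
      using V B by (intro card_mono) (auto simp: finite_imp_finite_nsets, auto simp: nsets_def)
    then show "card {A \<in> V. A \<subseteq> B} \<le> k choose l" using B by (simp add: card_nsets)
  qed
  finally show ?thesis by simp
qed

text \<open>On at most \<open>k + l\<close> points an \<open>l\<close>-set has no more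
  \<open>k\<close>-supersets than a \<open>k\<close>-set has \<open>l\<close>-subsets, so the two
  factors of the matching inequality cancel.\<close>

lemma card_le_card_shadow:
  assumes X: "finite X" and H: "H \<subseteq> nsets X k" and "l \<le> k" "card X \<le> k + l"
  shows "card H \<le> card (shadow l H)"
proof -
  have "card H * (k choose l) \<le> card (shadow l H) * ((card X - l) choose (k - l))"
    using assms by (intro normalized_matching_down) (auto simp: shadow_subset_nsets, auto simp: shadow_def)
  also have "(card X - l) choose (k - l) \<le> k choose (k - l)"
    using assms by (intro binomial_right_mono) auto
  also have "k choose (k - l) = k choose l"
    using binomial_symmetric[OF \<open>l \<le> k\<close>] by simp
  finally show ?thesis using \<open>l \<le> k\<close> by auto
qed

text \<open>Upward matching between the \<open>l\<close>-sets outside the shadow and the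
  \<open>k\<close>-sets outside \<open>H\<close>: every \<open>k\<close>-superset of the former is
  one of the latter. On at least \<open>k + l\<close> points this gives no more missing
  \<open>l\<close>-sets than missing \<open>k\<close>-sets.\<close>

lemma card_shadow_deficit:
  assumes X: "finite X" and H: "H \<subseteq> nsets X k" and "l \<le> k" "k + l \<le> card X"
  shows "int (card H) + int (card X choose l)
           \<le> int (card (shadow l H)) + int (card X choose k)"
proof -
  let ?U = "nsets X k - H" and ?V = "nsets X l - shadow l H"
  have S: "shadow l H \<subseteq> nsets X l" using H by (rule shadow_subset_nsets)
  have fin: "finite (nsets X k)" "finite (nsets X l)" using X by (simp_all add: finite_imp_finite_nsets)
  have "card ?V * (k choose l) = card ?V * (k choose (k - l))"
    using binomial_symmetric[OF \<open>l \<le> k\<close>] by simp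
  also have "\<dots> \<le> card ?V * ((card X - l) choose (k - l))"
    using assms by (intro mult_le_mono binomial_right_mono) auto
  also have "\<dots> \<le> card ?U * (k choose l)"
    using assms by (intro normalized_matching_up) (auto simp: in_shadow_iff nsets_def)
  finally have "card ?V \<le> card ?U" using \<open>l \<le> k\<close> by auto
  moreover have "card ?U = card (nsets X k) - card H" "card H \<le> card (nsets X k)"
    using card_mono[OF fin(1) H] H fin finite_subset[OF H] by (simp_all add: card_Diff_subset)
  moreover have "card ?V = card (nsets X l) - card (shadow l H)" "card (shadow l H) \<le> card (nsets X l)"
    using card_mono[OF fin(2) S] S fin finite_subset[OF S] by (simp_all add: card_Diff_subset)
  ultimately show ?thesis using X by (simp add: card_nsets)
qed

section \<open>Shifting\<close>

text \<open>Frankl's shift. A set stays in place when its image is already a member, which makes the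
  map injective on \<open>H\<close>.\<close>

definition shift :: "'a \<Rightarrow> 'a \<Rightarrow> 'a set set \<Rightarrow> 'a set set" where
  "shift s j H = (\<lambda>D. if j \<in> D \<and> s \<notin> D \<and> insert s (D - {j}) \<notin> H then insert s (D - {j}) else D) ` H"

text \<open>The sets containing exactly one of \<open>s\<close> and \<open>j\<close> fall into pairs
  under exchanging the two. The shifted family has the partner with \<open>s\<close> if
  \<open>H\<close> has either one, and the partner with \<open>j\<close> if \<open>H\<close> has
  both.\<close>

lemma in_shift_iff:
  assumes "s \<noteq> j"
  shows "D \<in> shift s j H \<longleftrightarrow>
    (if s \<in> D \<and> j \<notin> D then D \<in> H \<or> insert j (D - {s}) \<in> H
     else if j \<in> D \<and> s \<notin> D then D \<in> H \<and> insert s (D - {j}) \<in> H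
     else D \<in> H)" (is "_ \<longleftrightarrow> ?R")
proof
  assume "D \<in> shift s j H"
  then obtain C where C: "C \<in> H"
    and D: "D = (if j \<in> C \<and> s \<notin> C \<and> insert s (C - {j}) \<notin> H then insert s (C - {j}) else C)"
    by (auto simp: shift_def)
  show ?R
  proof (cases "j \<in> C \<and> s \<notin> C \<and> insert s (C - {j}) \<notin> H")
    case True
    then have "insert j (D - {s}) = C" "s \<in> D" "j \<notin> D" using D assms by auto
    then show ?thesis using C by simp
  next
    case False
    then have "D = C" using D by (simp only: if_False)
    then show ?thesis using C False by auto
  qed
next
  assume R: ?R
  show "D \<in> shift s j H"
  proof (cases "D \<in> H \<and> (j \<in> D \<and> s \<notin> D \<longrightarrow> insert s (D - {j}) \<in> H)")
    case True
    then show ?thesis unfolding shift_def by (intro image_eqI[of _ _ D]) auto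
  next
    case False
    then have D: "s \<in> D" "j \<notin> D" "D \<notin> H" "insert j (D - {s}) \<in> H" using R by (auto split: if_splits)
    have "insert s (insert j (D - {s}) - {j}) = D" using D assms by auto
    then show ?thesis unfolding shift_def using D assms
      by (intro image_eqI[of _ _ "insert j (D - {s})"]) simp_all
  qed
qed

lemma card_shift:
  assumes "s \<noteq> j"
  shows "card (shift s j H) = card H"
  unfolding shift_def
proof (rule card_image, rule inj_onI)
  have inv: "insert j (insert s (D - {j}) - {s}) = D" if "j \<in> D" "s \<notin> D" for D
    using that assms by blast
  fix C D assume "C \<in> H" "D \<in> H"
    "(if j \<in> C \<and> s \<notin> C \<and> insert s (C - {j}) \<notin> H then insert s (C - {j}) else C) =
     (if j \<in> D \<and> s \<notin> D \<and> insert s (D - {j}) \<notin> H then insert s (D - {j}) else D)"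
  then show "C = D" using inv[of C] inv[of D] by (smt (verit))
qed

lemma card_swap:
  assumes "finite D" "j \<in> D" "s \<notin> D"
  shows "card (insert s (D - {j})) = card D"
proof -
  have "card (insert s (D - {j})) = Suc (card (D - {j}))" using assms by simp
  also have "\<dots> = card D" using assms by (metis card_Suc_Diff1)
  finally show ?thesis .
qed

lemma swap_in_nsets:
  assumes "D \<in> nsets X k" "j \<in> D" "s \<notin> D" "s \<in> X"
  shows "insert s (D - {j}) \<in> nsets X k"
proof -
  have "finite D" "card D = k" "D \<subseteq> X" using assms by (auto simp: nsets_def)
  moreover from this have "card (insert s (D - {j})) = k" using assms card_swap[of D j s] by simp
  ultimately show ?thesis using assms by (auto simp: nsets_def)
qed

lemma shift_subset_nsets:
  assumes "H \<subseteq> nsets X k" "s \<in> X"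
  shows "shift s j H \<subseteq> nsets X k"
  unfolding shift_def
proof (rule image_subsetI)
  fix D assume "D \<in> H"
  then show "(if j \<in> D \<and> s \<notin> D \<and> insert s (D - {j}) \<notin> H then insert s (D - {j}) else D) \<in> nsets X k"
    using assms swap_in_nsets[of D X k j s] by (simp only: subset_iff split: if_split) blast
qed

text \<open>Together with \<open>card_shift\<close> this shows that shifting does not enlarge the
  shadow. The cases follow how \<open>E\<close> meets \<open>s\<close> and \<open>j\<close>; the
  demanding one is \<open>j\<close> alone, where both \<open>E\<close> and its partner must be in
  the old shadow.\<close>

lemma shadow_shift:
  assumes "s \<noteq> j"
  shows "shadow l (shift s j H) \<subseteq> shift s j (shadow l H)"
proof
  fix E assume "E \<in> shadow l (shift s j H)"
  then obtain D where E: "finite E" "card E = l" and D: "D \<in> shift s j H" and ED: "E \<subseteq> D"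
    by (auto simp: in_shadow_iff)
  have D1: "D \<in> H \<or> s \<in> D \<and> j \<notin> D \<and> insert j (D - {s}) \<in> H"
    and D2: "j \<in> D \<Longrightarrow> s \<notin> D \<Longrightarrow> insert s (D - {j}) \<in> H"
    using D unfolding in_shift_iff[OF assms] by presburger+
  consider (none) "s \<notin> E" "j \<notin> E" | (both) "s \<in> E" "j \<in> E" | (s) "s \<in> E" "j \<notin> E" | (j) "s \<notin> E" "j \<in> E"
    by blast
  then show "E \<in> shift s j (shadow l H)"
  proof cases
    case none
    then have "E \<subseteq> insert j (D - {s})" using ED by blast
    then have "\<exists>B\<in>H. E \<subseteq> B" using D1 ED by blast
    then show ?thesis using none E assms by (simp add: in_shift_iff in_shadow_iff)
  next
    case both
    then have "D \<in> H" using D1 ED by blast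
    then have "E \<in> shadow l H" using E ED by (auto simp: in_shadow_iff)
    then show ?thesis using both assms by (simp add: in_shift_iff)
  next
    case s
    have "E \<in> shadow l H \<or> insert j (E - {s}) \<in> shadow l H"
    proof (cases "D \<in> H")
      case True
      then show ?thesis using E ED by (auto simp: in_shadow_iff)
    next
      case False
      then have "insert j (D - {s}) \<in> H" using D1 by blast
      moreover have "insert j (E - {s}) \<subseteq> insert j (D - {s})" using ED by auto
      moreover have "card (insert j (E - {s})) = l" using E s card_swap[of E s j] by simp
      moreover have "finite (insert j (E - {s}))" using E by simp
      ultimately show ?thesis unfolding in_shadow_iff by blast
    qed
    then show ?thesis using s assms by (simp add: in_shift_iff)
  next
    case j
    have DH: "D \<in> H" using D1 ED j by blast
    have "\<exists>B\<in>H. insert s (E - {j}) \<subseteq> B"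
    proof (cases "s \<in> D")
      case True
      then show ?thesis using DH ED by auto
    next
      case False
      then have "insert s (D - {j}) \<in> H" using D2 ED j by blast
      moreover have "insert s (E - {j}) \<subseteq> insert s (D - {j})" using ED by auto
      ultimately show ?thesis by (rule rev_bexI)
    qed
    moreover have "card (insert s (E - {j})) = l" using E j card_swap[of E j s] by simp
    moreover have "finite (insert s (E - {j}))" using E by simp
    ultimately have "insert s (E - {j}) \<in> shadow l H" unfolding in_shadow_iff by blast
    moreover have "E \<in> shadow l H" using DH ED E by (auto simp: in_shadow_iff)
    ultimately show ?thesis using j assms by (simp add: in_shift_iff)
  qed
qed

text \<open>Among the families of the same size with no larger shadow, take one with the most
  members containing \<open>s\<close>. A shift that still moved a set would increase this
  number.\<close>

lemma ex_shift_stable: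
  assumes X: "finite X" "s \<in> X" and H: "H \<subseteq> nsets X k"
  obtains H' where "H' \<subseteq> nsets X k" "card H' = card H" "card (shadow l H') \<le> card (shadow l H)"
    "\<And>B j. B \<in> H' \<Longrightarrow> s \<notin> B \<Longrightarrow> j \<in> B \<Longrightarrow> insert s (B - {j}) \<in> H'"
proof -
  let ?P = "\<lambda>H'. H' \<subseteq> nsets X k \<and> card H' = card H \<and> card (shadow l H') \<le> card (shadow l H)"
  let ?f = "\<lambda>H'. card {D \<in> H'. s \<in> D}"
  have fin: "finite H'" if "?P H'" for H' using that X finite_family by blast
  have "?f H' < Suc (card H)" if "?P H'" for H'
  proof -
    have "?f H' \<le> card H'" using fin[OF that] by (intro card_mono) auto
    then show ?thesis using that by simp
  qed
  then obtain H' where H': "?P H'" and max: "\<And>G. ?P G \<Longrightarrow> ?f G \<le> ?f H'"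
    using ex_has_greatest_nat[of ?P H ?f "Suc (card H)"] H by auto
  have "insert s (B - {j}) \<in> H'" if B: "B \<in> H'" "s \<notin> B" "j \<in> B" for B j
  proof (rule ccontr)
    assume not: "insert s (B - {j}) \<notin> H'"
    have sj: "s \<noteq> j" using B by auto
    let ?G = "shift s j H'"
    have sh: "finite (shadow l H')" using finite_shadow fin H' by blast
    have "card (shadow l ?G) \<le> card (shift s j (shadow l H'))"
      using sh by (intro card_mono shadow_shift[OF sj]) (simp add: shift_def)
    then have G: "?P ?G"
      using H' shift_subset_nsets[of H' X k s j] X card_shift[OF sj] by (auto simp: card_shift[OF sj])
    have "insert s (B - {j}) \<in> ?G"
      unfolding shift_def using B not by (intro image_eqI[of _ _ B]) auto
    moreover have "{D \<in> H'. s \<in> D} \<subseteq> {D \<in> ?G. s \<in> D}"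
      using sj by (simp add: in_shift_iff subset_iff)
    ultimately have "{D \<in> H'. s \<in> D} \<subset> {D \<in> ?G. s \<in> D}" using not by blast
    then have "?f H' < ?f ?G" using fin[OF G] by (intro psubset_card_mono) auto
    then show False using max[OF G] by simp
  qed
  then show thesis using that H' by blast
qed

section \<open>The colexicographic order\<close>

text \<open>The highest differing bit decides, because all bits below \<open>d\<close> sum to less
  than \<open>2 ^ d\<close>.\<close>

lemma set_encode_less:
  assumes "finite A" "finite B" "d \<in> B" "d \<notin> A" and above: "\<And>i. d < i \<Longrightarrow> i \<in> A \<longleftrightarrow> i \<in> B"
  shows "set_encode A < set_encode B"
proof -
  let ?C = "A \<inter> {d<..}"
  have "i < d \<or> d < i" if "i \<in> A" for i
    using that assms(4) by (cases i d rule: linorder_cases) auto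
  then have A: "(A \<inter> {..<d}) \<union> ?C = A" by blast
  have "set_encode (A \<inter> {..<d}) \<le> (\<Sum>i<d. 2 ^ i)"
    unfolding set_encode_def by (rule sum_mono2) auto
  also have "\<dots> < 2 ^ d" by (simp add: mask_eq_sum_exp_nat[symmetric] lessThan_def)
  finally have low: "set_encode (A \<inter> {..<d}) < 2 ^ d" .
  have "set_encode ((A \<inter> {..<d}) \<union> ?C) = set_encode (A \<inter> {..<d}) + set_encode ?C"
    unfolding set_encode_def using assms(1) by (intro sum.union_disjoint) auto
  then have "set_encode A = set_encode (A \<inter> {..<d}) + set_encode ?C" unfolding A .
  also have "\<dots> < 2 ^ d + set_encode ?C" using low by simp
  also have "\<dots> = set_encode (insert d ?C)" using assms(1) by simp
  also have "\<dots> \<le> set_encode B"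
    unfolding set_encode_def using assms by (intro sum_mono2) auto
  finally show ?thesis .
qed

text \<open>The converse, with \<open>d\<close> the maximum of the symmetric difference.\<close>

lemma set_encode_lessE:
  assumes "finite A" "finite B" "set_encode A < set_encode B"
  obtains d where "d \<in> B" "d \<notin> A" "\<And>i. d < i \<Longrightarrow> i \<in> A \<longleftrightarrow> i \<in> B"
proof -
  let ?S = "(A - B) \<union> (B - A)"
  have ne: "?S \<noteq> {}" and fin: "finite ?S" using assms by auto
  let ?d = "Max ?S"
  have d: "?d \<in> ?S" using Max_in[OF fin ne] .
  have above: "i \<in> A \<longleftrightarrow> i \<in> B" if "?d < i" for i
  proof -
    have "i \<notin> ?S" using Max_ge[OF fin, of i] that by (meson not_le)
    then show ?thesis by blast
  qed
  have "?d \<in> B"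
  proof (rule ccontr)
    assume "?d \<notin> B"
    then have "set_encode B < set_encode A" using d assms above by (intro set_encode_less[of _ _ ?d]) blast+
    then show False using assms by simp
  qed
  then show thesis using that[of ?d] d above by blast
qed

text \<open>Since \<^term>\<open>set_encode A\<close> is the sum of \<open>2 ^ i\<close> over \<open>i \<in> A\<close>, comparing codes is the colex order.\<close>

definition colex_initial :: "nat \<Rightarrow> nat \<Rightarrow> nat set set \<Rightarrow> bool" where
  "colex_initial s k I \<longleftrightarrow> I \<subseteq> nsets {s..} k \<and>
     (\<forall>A\<in>I. \<forall>B\<in>nsets {s..} k. set_encode B < set_encode A \<longrightarrow> B \<in> I)"

lemma colex_initialD:
  assumes "colex_initial s k I" "A \<in> I" "B \<in> nsets {s..} k" "set_encode B \<le> set_encode A"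
  shows "B \<in> I"
proof (cases "B = A")
  case False
  have "finite A" "finite B" using assms by (auto simp: colex_initial_def nsets_def)
  then have "set_encode B < set_encode A" using assms(4) False set_encode_eq by force
  then show ?thesis using assms by (auto simp: colex_initial_def)
qed (use assms in simp)

lemma colex_initial_subset: "colex_initial s k I \<Longrightarrow> I \<subseteq> nsets {s..} k"
  by (simp add: colex_initial_def)

text \<open>The new set is the missing \<open>k\<close>-set of least code.\<close>

lemma colex_initial_next:
  assumes I: "colex_initial s k I" "finite I" and "k \<ge> 1"
  obtains B where "B \<in> nsets {s..} k" "B \<notin> I" "colex_initial s k (insert B I)"
proof -
  have "finite (\<Union>I)" using I by (auto simp: colex_initial_def nsets_def)
  then obtain M where M: "\<And>i. i \<in> \<Union>I \<Longrightarrow> i < M" by (metis finite_nat_set_iff_bounded)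
  \<comment> \<open>A block of \<open>k\<close> consecutive integers beyond all members of
    \<open>I\<close>; it only witnesses that some \<open>k\<close>-set is missing.\<close>
  let ?C = "{max s M..<max s M + k}"
  have "max s M \<in> ?C" using assms(3) by simp
  then have "?C \<notin> I" using M[of "max s M"] by (meson UnionI max.cobounded2 not_le)
  moreover have "?C \<in> nsets {s..} k" by (auto simp: nsets_def)
  ultimately obtain B where B: "B \<in> nsets {s..} k \<and> B \<notin> I"
    and least: "\<And>C. C \<in> nsets {s..} k \<and> C \<notin> I \<Longrightarrow> set_encode B \<le> set_encode C"
    using ex_has_least_nat[of "\<lambda>C. C \<in> nsets {s..} k \<and> C \<notin> I" ?C set_encode] by blast
  have "colex_initial s k (insert B I)"
    unfolding colex_initial_def
  proof (intro conjI ballI impI)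
    show "insert B I \<subseteq> nsets {s..} k" using B I colex_initial_subset by blast
    fix A C assume *: "A \<in> insert B I" "C \<in> nsets {s..} k" "set_encode C < set_encode A"
    show "C \<in> insert B I"
    proof (cases "A = B")
      case True
      then show ?thesis using least[of C] * by force
    next
      case False
      then show ?thesis using I * by (auto simp: colex_initial_def)
    qed
  qed
  then show thesis using B that by blast
qed

lemma ex_colex_initial:
  assumes "k \<ge> 1"
  shows "\<exists>I. colex_initial s k I \<and> finite I \<and> card I = m"
proof (induction m)
  case 0
  show ?case by (rule exI[of _ "{}"]) (simp add: colex_initial_def)
next
  case (Suc m)
  then obtain I where I: "colex_initial s k I" "finite I" "card I = m" by blast
  then obtain B where "B \<notin> I" "colex_initial s k (insert B I)"
    using colex_initial_next assms by blast
  then show ?case using I by (intro exI[of _ "insert B I"]) simp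
qed

text \<open>Initial segments of a linear order form a chain: an \<open>A\<close> in \<open>I\<close>
  but not in \<open>J\<close> comes after every member of \<open>J\<close>, so \<open>J\<close>
  would be a proper subset of \<open>I\<close>.\<close>

lemma colex_initial_nested:
  assumes I: "colex_initial s k I" "finite I" and J: "colex_initial s k J" "finite J"
    and le: "card I \<le> card J"
  shows "I \<subseteq> J"
proof (rule ccontr)
  assume "\<not> I \<subseteq> J"
  then obtain A where A: "A \<in> I" "A \<notin> J" by blast
  have "J \<subseteq> I"
  proof
    fix B assume B: "B \<in> J"
    have "\<not> set_encode A \<le> set_encode B"
      using colex_initialD[OF J(1) B, of A] A I colex_initial_subset by blast
    then show "B \<in> I"
      using colex_initialD[OF I(1) A(1), of B] B J colex_initial_subset by fastforce
  qed
  then have "J \<subset> I" using A by blast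
  then have "card J < card I" by (rule psubset_card_mono[OF I(2)])
  then show False using le by simp
qed

text \<open>A set with an element beyond \<open>x\<close> comes after every subset of
  \<open>{s..x}\<close>, its maximum being the deciding element.\<close>

lemma colex_initial_full: "colex_initial s k (nsets {s..x} k)"
  unfolding colex_initial_def
proof (intro conjI ballI impI)
  show "nsets {s..x} k \<subseteq> nsets {s..} k" by (auto simp: nsets_def)
  fix A C assume A: "A \<in> nsets {s..x} k" and C: "C \<in> nsets {s..} k"
    and less: "set_encode C < set_encode A"
  have fin: "finite C" "finite A" using A C by (auto simp: nsets_def)
  have "C \<subseteq> {..x}"
  proof (rule ccontr)
    assume "\<not> ?thesis"
    then obtain i where i: "i \<in> C" "x < i" by (meson atMost_iff not_le subsetI)
    have M: "Max C \<in> C" using Max_in[OF fin(1)] i by blast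
    have xM: "x < Max C" using Max_ge[OF fin(1) i(1)] i(2) by linarith
    have "set_encode A < set_encode C"
    proof (rule set_encode_less[OF fin(2,1) M])
      show "Max C \<notin> A" using xM A by (auto simp: nsets_def)
      show "i \<in> A \<longleftrightarrow> i \<in> C" if "Max C < i" for i
        using that xM A Max_ge[OF fin(1), of i] by (auto simp: nsets_def)
    qed
    then show False using less by simp
  qed
  then show "C \<in> nsets {s..x} k" using C by (auto simp: nsets_def)
qed

section \<open>Links and deletions\<close>

definition link :: "'a \<Rightarrow> 'a set set \<Rightarrow> 'a set set" where
  "link s H = {A. s \<notin> A \<and> insert s A \<in> H}"

definition del :: "'a \<Rightarrow> 'a set set \<Rightarrow> 'a set set" where
  "del s H = {A \<in> H. s \<notin> A}"

lemma link_subset_nsets: "H \<subseteq> nsets X k \<Longrightarrow> link s H \<subseteq> nsets (X - {s}) (k - 1)"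
proof
  fix A assume H: "H \<subseteq> nsets X k" and "A \<in> link s H"
  then have "s \<notin> A" "insert s A \<in> nsets X k" by (auto simp: link_def)
  then show "A \<in> nsets (X - {s}) (k - 1)" by (auto simp: nsets_def)
qed

lemma del_subset_nsets: "H \<subseteq> nsets X k \<Longrightarrow> del s H \<subseteq> nsets (X - {s}) k"
  by (auto simp: nsets_def del_def)

lemma inj_on_insert: "(\<And>A. A \<in> K \<Longrightarrow> s \<notin> A) \<Longrightarrow> inj_on (insert s) K"
  by (rule inj_onI) (metis insert_ident)

lemma insert_image_link: "insert s ` link s H = {A \<in> H. s \<in> A}"
proof
  show "{A \<in> H. s \<in> A} \<subseteq> insert s ` link s H"
  proof
    fix A assume "A \<in> {A \<in> H. s \<in> A}"
    then show "A \<in> insert s ` link s H"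
      by (intro image_eqI[of _ _ "A - {s}"]) (auto simp: link_def insert_absorb)
  qed
qed (auto simp: link_def)

lemma finite_link: "finite H \<Longrightarrow> finite (link s H)"
proof -
  assume "finite H"
  then have "finite (insert s ` link s H)" by (simp add: insert_image_link)
  then show ?thesis by (rule finite_imageD) (auto intro: inj_on_insert simp: link_def)
qed

lemma card_link_del:
  assumes "finite H"
  shows "card H = card (link s H) + card (del s H)"
proof -
  have "card (link s H) = card (insert s ` link s H)"
    by (rule card_image[symmetric]) (auto intro: inj_on_insert simp: link_def)
  then have "card (link s H) = card {A \<in> H. s \<in> A}" by (simp add: insert_image_link)
  moreover have "H = {A \<in> H. s \<in> A} \<union> del s H" by (auto simp: del_def)
  moreover have "card ({A \<in> H. s \<in> A} \<union> del s H) = card {A \<in> H. s \<in> A} + card (del s H)"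
    using assms by (intro card_Un_disjoint) (auto simp: del_def)
  ultimately show ?thesis by metis
qed

lemma card_cone:
  assumes "finite P" "finite Q" "\<And>A. A \<in> P \<union> Q \<Longrightarrow> s \<notin> A"
  shows "card (insert s ` P \<union> Q) = card P + card Q"
proof -
  have "card (insert s ` P \<union> Q) = card (insert s ` P) + card Q"
    using assms by (intro card_Un_disjoint) auto
  also have "card (insert s ` P) = card P"
    using assms by (intro card_image inj_on_insert) auto
  finally show ?thesis .
qed

lemma not_in_shadow_link: "A \<in> shadow l (link s H) \<Longrightarrow> s \<notin> A"
  by (auto simp: in_shadow_iff link_def)

lemma finite_shadow_link: "finite H \<Longrightarrow> H \<subseteq> nsets X k \<Longrightarrow> finite (shadow l (link s H))"
  using finite_shadow finite_link link_subset_nsets by metis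

lemma insert_shadow_link_subset:
  assumes "l \<ge> 1"
  shows "insert s ` shadow (l - 1) (link s H) \<subseteq> shadow l H"
proof
  fix D assume "D \<in> insert s ` shadow (l - 1) (link s H)"
  then obtain A B where D: "D = insert s A" and A: "finite A" "card A = l - 1" "A \<subseteq> B" "s \<notin> B" "insert s B \<in> H"
    by (auto simp: in_shadow_iff link_def)
  then have "s \<notin> A" by blast
  then have "card D = l" "finite D" "D \<subseteq> insert s B" using D A assms by auto
  then show "D \<in> shadow l H" using A unfolding in_shadow_iff by blast
qed

text \<open>The shadow contains the cone with apex \<open>s\<close> over the lower shadow of the
  link and also the \<open>l\<close>-shadow of the link; the two are disjoint since only sets of the
  cone contain \<open>s\<close>.\<close>

lemma card_shadow_ge:
  assumes H: "H \<subseteq> nsets X k" "finite H" and "l \<ge> 1"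
  shows "card (shadow (l - 1) (link s H)) + card (shadow l (link s H)) \<le> card (shadow l H)"
proof -
  let ?P = "shadow (l - 1) (link s H)" and ?Q = "shadow l (link s H)"
  have "insert s ` ?P \<subseteq> shadow l H" using insert_shadow_link_subset assms(3) .
  moreover have "?Q \<subseteq> shadow l H" unfolding subset_iff in_shadow_iff link_def
    by blast
  moreover have "card (insert s ` ?P \<union> ?Q) = card ?P + card ?Q"
    using H by (intro card_cone) (auto intro: finite_shadow_link dest: not_in_shadow_link)
  moreover have "finite (shadow l H)" using H finite_shadow by blast
  ultimately show ?thesis by (metis Un_least card_mono)
qed

text \<open>For a stable family the bound of \<open>card_shadow_ge\<close> is attained. If
  \<open>D\<close> and its superset \<open>B\<close> both avoid \<open>s\<close>, then
  \<open>l < k\<close> leaves some \<open>y\<close> in \<open>B\<close> outside \<open>D\<close>,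
  and exchanging \<open>y\<close> for \<open>s\<close> puts \<open>D\<close> below a member of the
  link.\<close>

lemma card_shadow_le:
  assumes H: "H \<subseteq> nsets X k" "finite H" and "l \<ge> 1" "l < k"
    and stable: "\<And>A y. s \<notin> A \<Longrightarrow> y \<notin> A \<Longrightarrow> insert y A \<in> H \<Longrightarrow> insert s A \<in> H"
  shows "card (shadow l H) \<le> card (shadow (l - 1) (link s H)) + card (shadow l (link s H))"
proof -
  let ?P = "shadow (l - 1) (link s H)" and ?Q = "shadow l (link s H)"
  have "shadow l H \<subseteq> insert s ` ?P \<union> ?Q"
  proof
    fix D assume "D \<in> shadow l H"
    then obtain B where D: "finite D" "card D = l" "D \<subseteq> B" "B \<in> H" by (auto simp: in_shadow_iff)
    then have B: "finite B" "card B = k" using H by (auto simp: nsets_def)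
    show "D \<in> insert s ` ?P \<union> ?Q"
    proof (cases "s \<in> D")
      case True
      have "B - {s} \<in> link s H" using D True by (auto simp: link_def insert_absorb)
      moreover have "finite (D - {s})" "card (D - {s}) = l - 1" "D - {s} \<subseteq> B - {s}" using D True by auto
      ultimately have "D - {s} \<in> ?P" unfolding in_shadow_iff by blast
      then have "D \<in> insert s ` ?P" using True by (intro image_eqI[of _ _ "D - {s}"]) auto
      then show ?thesis by blast
    next
      case False
      have "\<exists>A. D \<subseteq> A \<and> A \<in> link s H"
      proof (cases "s \<in> B")
        case True
        then have "B - {s} \<in> link s H" using D by (auto simp: link_def insert_absorb)
        moreover have "D \<subseteq> B - {s}" using D False by blast
        ultimately show ?thesis by blast
      next
        case sB: False
        have "D \<noteq> B" using D B assms(4) by auto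
        then obtain y where y: "y \<in> B" "y \<notin> D" using D by blast
        have "insert s (B - {y}) \<in> H"
          using stable[of "B - {y}" y] sB y D by (simp add: insert_absorb)
        then have "B - {y} \<in> link s H" using sB by (simp add: link_def)
        moreover have "D \<subseteq> B - {y}" using D y by blast
        ultimately show ?thesis by blast
      qed
      then have "D \<in> ?Q" using D by (auto simp: in_shadow_iff)
      then show ?thesis by blast
    qed
  qed
  moreover have "card (insert s ` ?P \<union> ?Q) = card ?P + card ?Q" and "finite (insert s ` ?P \<union> ?Q)"
    using H by (auto intro!: card_cone intro: finite_shadow_link dest: not_in_shadow_link)
  ultimately show ?thesis by (metis card_mono)
qed

lemma atLeast_minus: "{s..} - {s} = {Suc s..}" for s :: nat
  by auto

text \<open>Replacing an element by the least ground element \<open>s\<close> cannot increase the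
  code, so initial segments are already shifted towards \<open>s\<close>.\<close>

lemma colex_initial_stable:
  assumes I: "colex_initial s k I" and A: "s \<notin> A" "y \<notin> A" "insert y A \<in> I"
  shows "insert s A \<in> I"
proof -
  have fin: "finite A" and y: "s \<le> y" and Ak: "insert y A \<subseteq> {s..}" "card (insert y A) = k"
    using colex_initial_subset[OF I] A(3) by (auto simp: nsets_def)
  have "insert s A \<in> nsets {s..} k" using fin A Ak by (auto simp: nsets_def)
  moreover have "set_encode (insert s A) \<le> set_encode (insert y A)" using fin A y by simp
  ultimately show ?thesis using colex_initialD[OF I A(3)] by blast
qed

lemma colex_initial_link:
  assumes I: "colex_initial s k I" and "k \<ge> 1"
  shows "colex_initial (Suc s) (k - 1) (link s I)"
  unfolding colex_initial_def
proof (intro conjI ballI impI)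
  show sub: "link s I \<subseteq> nsets {Suc s..} (k - 1)"
    using link_subset_nsets[OF colex_initial_subset[OF I], of s] by (simp add: atLeast_minus)
  fix A B assume A: "A \<in> link s I" and B: "B \<in> nsets {Suc s..} (k - 1)" and less: "set_encode B < set_encode A"
  have "A \<in> nsets {Suc s..} (k - 1)" using A sub by blast
  then have fin: "finite A" "s \<notin> A" "finite B" "s \<notin> B" using B by (auto simp: nsets_def)
  have "insert s B \<in> nsets {s..} k" using B fin assms(2) by (auto simp: nsets_def)
  moreover have "set_encode (insert s B) \<le> set_encode (insert s A)" using less fin by simp
  moreover have "insert s A \<in> I" using A by (simp add: link_def)
  ultimately have "insert s B \<in> I" using colex_initialD[OF I] by blast
  then show "B \<in> link s I" using fin by (simp add: link_def)
qed

lemma colex_initial_del: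
  assumes I: "colex_initial s k I"
  shows "colex_initial (Suc s) k (del s I)"
  unfolding colex_initial_def
proof (intro conjI ballI impI)
  show "del s I \<subseteq> nsets {Suc s..} k"
    using del_subset_nsets[OF colex_initial_subset[OF I], of s] by (simp add: atLeast_minus)
  fix A B assume A: "A \<in> del s I" and B: "B \<in> nsets {Suc s..} k" and less: "set_encode B < set_encode A"
  have "B \<in> nsets {s..} k" "s \<notin> B" using B by (auto simp: nsets_def)
  then show "B \<in> del s I" using A less colex_initialD[OF I, of A B] by (simp add: del_def)
qed

text \<open>If \<open>insert s A\<close> is in \<open>I\<close>, the first \<open>k\<close>-set
  after it that avoids \<open>s\<close> arises by exchanging \<open>s\<close> for the least gap
  \<open>t\<close> of \<open>A\<close> above \<open>s\<close>. That set contains \<open>A\<close>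
  and comes no later than \<open>B\<close>.\<close>

lemma link_subset_shadow_next:
  assumes I: "colex_initial s k I" and B: "B \<in> nsets {Suc s..} k" "B \<notin> I"
    and J: "colex_initial (Suc s) k (insert B (del s I))" and "k \<ge> 1"
  shows "link s I \<subseteq> shadow (k - 1) (insert B (del s I))"
proof
  fix A assume "A \<in> link s I"
  then have A: "s \<notin> A" "insert s A \<in> I" "A \<in> nsets {Suc s..} (k - 1)"
    using colex_initial_link[OF I assms(5)] colex_initial_subset by (auto simp: link_def)
  then have fin: "finite A" "card A = k - 1" and As: "A \<subseteq> {Suc s..}" by (auto simp: nsets_def)
  have finB: "finite B" "card B = k" and Bs: "B \<subseteq> {Suc s..}" using B by (auto simp: nsets_def)
  define t where "t = (LEAST t. s < t \<and> t \<notin> A)"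
  obtain M where "\<And>i. i \<in> A \<Longrightarrow> i < M" using fin(1) by (metis finite_nat_set_iff_bounded)
  then have "s < max M (Suc s) \<and> max M (Suc s) \<notin> A" by fastforce
  then have t: "s < t" "t \<notin> A" unfolding t_def by (metis (mono_tags, lifting) LeastI)+
  have below: "i \<in> A" if "s < i" "i < t" for i
    using not_less_Least[of i "\<lambda>t. s < t \<and> t \<notin> A"] that by (auto simp: t_def)
  let ?D = "insert t A"
  have D: "finite ?D" "card ?D = k" "?D \<in> nsets {Suc s..} k"
    using fin t As assms(5) by (auto simp: nsets_def)
  have sB: "B \<in> nsets {s..} k" using B by (auto simp: nsets_def)
  have "set_encode (insert s A) < set_encode B"
    using colex_initialD[OF I A(2) sB] B(2) by force
  then obtain d where d: "d \<in> B" "d \<notin> insert s A" and above: "\<And>i. d < i \<Longrightarrow> i \<in> insert s A \<longleftrightarrow> i \<in> B"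
    using set_encode_lessE[of "insert s A" B] fin finB by auto
  have sd: "s < d" using d(1) Bs by auto
  \<comment> \<open>All integers strictly between \<open>s\<close> and \<open>t\<close> belong to
    \<open>A\<close>, so the deciding element \<open>d\<close> cannot be one of them.\<close>
  then have "t \<le> d" using below d(2) by (meson insertCI not_le)
  have "set_encode ?D \<le> set_encode B"
  proof (cases "d = t")
    case True
    have "B \<subseteq> ?D"
    proof
      fix i assume i: "i \<in> B"
      then have "s < i" using Bs by auto
      then show "i \<in> ?D" using below[of i] above[of i] i True by (cases i t rule: linorder_cases) auto
    qed
    then have "B = ?D" using D finB by (intro card_subset_eq) auto
    then show ?thesis by simp
  next
    case False
    have "set_encode ?D < set_encode B"
    proof (rule set_encode_less[OF D(1) finB(1) d(1)])
      show "d \<notin> ?D" using d False by auto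
      show "i \<in> ?D \<longleftrightarrow> i \<in> B" if "d < i" for i
        using above[OF that] that \<open>t \<le> d\<close> sd by auto
    qed
    then show ?thesis by simp
  qed
  then have "?D \<in> insert B (del s I)" using colex_initialD[OF J _ D(3), of B] by blast
  then show "A \<in> shadow (k - 1) (insert B (del s I))"
    unfolding in_shadow_iff using fin by blast
qed

section \<open>The Kruskal--Katona theorem\<close>

text \<open>Induction on the size of the ground interval, with \<open>s\<close> varying because
  links at \<open>s\<close> live on \<open>{Suc s..}\<close>. After stabilizing \<open>H\<close> at
  \<open>s\<close>, both shadows are governed by the links, and the induction hypothesis compares
  these at levels \<open>l - 1\<close> and \<open>l\<close>.\<close>

theorem kruskal_katona:
  assumes "H \<subseteq> nsets {s..<N} k" "colex_initial s k I" "finite I" "card I \<le> card H" "l \<le> k"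
  shows "card (shadow l I) \<le> card (shadow l H)"
  using assms
proof (induction "N - s" arbitrary: s k l H I rule: less_induct)
  case less
  note H = less.prems(1) and I = less.prems(2,3) and le = less.prems(4)
  have Isub: "I \<subseteq> nsets {s..} k" using I colex_initial_subset by blast
  have finH: "finite H" using H finite_family by blast
  show ?case
  proof (cases "l = k \<or> H = {} \<or> l = 0")
    case True
    then consider "l = k" | "H = {}" | "l = 0" by blast
    then show ?thesis
    proof cases
      case 1
      then show ?thesis using le shadow_self[OF H] shadow_self[OF Isub] by simp
    next
      case 2
      then show ?thesis using le I by (simp add: shadow_def)
    next
      case 3
      then show ?thesis using le I shadow_0[OF H] shadow_0[OF Isub] by auto
    qed
  next
    case False
    then have l: "1 \<le> l" "l < k" "H \<noteq> {}" using less.prems(5) by auto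
    then obtain C where "C \<in> nsets {s..<N} k" using H by blast
    then have "s < N" using l by (auto simp: nsets_def)
    then have dec: "N - Suc s < N - s" and s: "s \<in> {s..<N}" by auto
    obtain H' where H': "H' \<subseteq> nsets {s..<N} k" "card H' = card H"
      and sh: "card (shadow l H') \<le> card (shadow l H)"
      and stable: "\<And>B j. B \<in> H' \<Longrightarrow> s \<notin> B \<Longrightarrow> j \<in> B \<Longrightarrow> insert s (B - {j}) \<in> H'"
      using ex_shift_stable[OF _ s H, of l] by auto
    have fin': "finite H'" using H' finite_family by blast
    have ground: "{s..<N} - {s} = {Suc s..<N}" by auto
    have link': "link s H' \<subseteq> nsets {Suc s..<N} (k - 1)"
      using link_subset_nsets[OF H'(1), of s] by (simp add: ground)
    have del': "del s H' \<subseteq> nsets {Suc s..<N} k"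
      using del_subset_nsets[OF H'(1), of s] by (simp add: ground)
    have linkI: "colex_initial (Suc s) (k - 1) (link s I)" using colex_initial_link I l by simp
    have delI: "colex_initial (Suc s) k (del s I)" "finite (del s I)"
      using colex_initial_del I by (auto simp: del_def)
    \<comment> \<open>Otherwise \<open>del s H'\<close> is larger than \<open>del s I\<close>, so its shadow is at least as large as that of
      the segment following \<open>del s I\<close>, which covers \<open>link s I\<close>; but that shadow lies in \<open>link s H'\<close>.\<close>
    have link_le: "card (link s I) \<le> card (link s H')"
    proof (rule ccontr)
      assume not: "\<not> ?thesis"
      then have "card (del s I) < card (del s H')"
        using card_link_del[OF fin', of s] card_link_del[OF I(2), of s] H'(2) le by linarith
      moreover obtain B where B: "B \<in> nsets {Suc s..} k" "B \<notin> del s I"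
        "colex_initial (Suc s) k (insert B (del s I))"
        using colex_initial_next[OF delI] l by auto
      ultimately have "card (shadow (k - 1) (insert B (del s I))) \<le> card (shadow (k - 1) (del s H'))"
        using delI by (intro less.hyps[OF dec del']) auto
      moreover have "shadow (k - 1) (del s H') \<subseteq> link s H'"
      proof
        fix E assume "E \<in> shadow (k - 1) (del s H')"
        then obtain D where E: "finite E" "card E = k - 1" "E \<subseteq> D" and D: "D \<in> H'" "s \<notin> D"
          by (auto simp: in_shadow_iff del_def)
        \<comment> \<open>\<open>E\<close> is \<open>D\<close> without one element \<open>y\<close>,
          and stability allows \<open>s\<close> to take the place of \<open>y\<close>.\<close>
        have Dk: "finite D" "card D = k" using D H' by (auto simp: nsets_def)
        then have "card (D - E) = 1" using E l by (simp add: card_Diff_subset)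
        then obtain y where "D - E = {y}" by (rule card_1_singletonE)
        then have "y \<in> D" "D - {y} = E" using E by auto
        then show "E \<in> link s H'" using stable[OF D, of y] D E by (auto simp: link_def)
      qed
      then have "card (shadow (k - 1) (del s H')) \<le> card (link s H')"
        using finite_link[OF fin'] by (rule card_mono[rotated])
      moreover have "B \<notin> I" using B by (auto simp: del_def nsets_def)
      then have "link s I \<subseteq> shadow (k - 1) (insert B (del s I))"
        using I B l by (intro link_subset_shadow_next) auto
      then have "card (link s I) \<le> card (shadow (k - 1) (insert B (del s I)))"
        using B delI by (intro card_mono finite_shadow[of _ "{Suc s..}" k] colex_initial_subset) auto
      ultimately show False using not by linarith
    qed
    have finl: "finite (link s I)" using finite_link[OF I(2)] .
    have "card (shadow l I) \<le> card (shadow (l - 1) (link s I)) + card (shadow l (link s I))"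
      by (rule card_shadow_le[OF Isub I(2) l(1,2) colex_initial_stable[OF I(1)]])
    also have "\<dots> \<le> card (shadow (l - 1) (link s H')) + card (shadow l (link s H'))"
      using l by (intro add_mono less.hyps[OF dec link' linkI finl link_le]) auto
    also have "\<dots> \<le> card (shadow l H')"
      using card_shadow_ge[OF H'(1) fin' l(1)] .
    finally show ?thesis using sh by simp
  qed
qed

section \<open>Decomposing a colexicographic initial segment\<close>

text \<open>The function \<phi> of the overview. For \<open>l \<le> k \<le> x\<close> it is the
  shadow size minus the size of the family of all \<open>k\<close>-subsets of an
  \<open>x\<close>-set.\<close>

definition excess :: "nat \<Rightarrow> nat \<Rightarrow> nat \<Rightarrow> int" where
  "excess k l x = int (x choose l) - int (x choose k)"

text \<open>Pascal's rule for both terms; the recursion mirrors splitting a segment at its largest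
  ground element.\<close>

lemma excess_Suc:
  assumes "1 \<le> k" "1 \<le> l"
  shows "excess k l (Suc x) = excess k l x + excess (k - 1) (l - 1) x"
  using assms by (cases k; cases l) (simp_all add: excess_def)

lemma excess_nonneg:
  assumes "l \<le> k" "x \<le> k + l"
  shows "0 \<le> excess k l x"
proof -
  let ?H = "nsets {..<x} k"
  have "card ?H \<le> card (shadow l ?H)" using assms by (intro card_le_card_shadow[of "{..<x}"]) auto
  also have "\<dots> \<le> card (nsets {..<x} l)"
    by (intro card_mono shadow_subset_nsets[of _ _ k]) (simp_all add: finite_imp_finite_nsets)
  finally show ?thesis by (simp add: card_nsets excess_def)
qed

lemma excess_eq_0: "excess k l (k + l) = 0"
  using binomial_symmetric[of k "k + l"] by (simp add: excess_def)

text \<open>The increment at \<open>x\<close> is \<open>excess (k - 1) (l - 1) x\<close>, which is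
  nonnegative as long as \<open>x \<le> k + l - 2\<close>.\<close>

lemma excess_mono:
  assumes "1 \<le> l" "l \<le> k" "y \<le> x" "x \<le> k + l - 1"
  shows "excess k l y \<le> excess k l x"
  using assms(3,4)
proof (induction x rule: dec_induct)
  case (step x)
  have "0 \<le> excess (k - 1) (l - 1) x" using assms(1,2) step by (intro excess_nonneg) auto
  then show ?case using step assms(1,2) excess_Suc[of k l x] by simp
qed simp

lemma subset_initial_interval:
  assumes "colex_initial 1 k I" "finite I" "card I \<le> x choose k"
  shows "I \<subseteq> nsets {1..x} k"
  using assms by (intro colex_initial_nested[OF _ _ colex_initial_full])
    (simp_all add: finite_imp_finite_nsets card_nsets)

lemma initial_interval_subset:
  assumes "colex_initial 1 k I" "finite I" "x choose k \<le> card I"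
  shows "nsets {1..x} k \<subseteq> I"
  using assms by (intro colex_initial_nested[OF colex_initial_full])
    (simp_all add: finite_imp_finite_nsets card_nsets)

lemma nsets_subset_shadow:
  assumes "l \<le> k" "k \<le> x" "nsets {1..x} k \<subseteq> I"
  shows "nsets {1..x} l \<subseteq> shadow l I"
proof
  fix A assume A: "A \<in> nsets {1..x} l"
  have "0 < card {B \<in> nsets {1..x} k. A \<subseteq> B}"
    using card_supersets[OF _ A assms(1)] assms(2) by simp
  then have "{B \<in> nsets {1..x} k. A \<subseteq> B} \<noteq> {}" by (metis card.empty less_irrefl)
  then show "A \<in> shadow l I" using A assms(3) by (auto simp: in_shadow_iff nsets_def)
qed

text \<open>The size bounds place \<open>I\<close> between the full families on
  \<open>{1..x}\<close> and \<open>{1..Suc x}\<close>. Hence its members avoiding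
  \<open>Suc x\<close> are all \<open>k\<close>-subsets of \<open>{1..x}\<close>, and
  \<open>I'\<close> is the link of \<open>Suc x\<close>. The shadow contains all
  \<open>l\<close>-subsets of \<open>{1..x}\<close> and the cone over the shadow of
  \<open>I'\<close>.\<close>

lemma colex_decompose:
  assumes I: "colex_initial 1 k I" "finite I" and "1 \<le> l" "l \<le> k" "k \<le> x"
    and ge: "x choose k \<le> card I" and le: "card I \<le> Suc x choose k"
  obtains I' where "colex_initial 1 (k - 1) I'" "finite I'"
    "card I = (x choose k) + card I'" "card I' \<le> x choose (k - 1)"
    "(x choose l) + card (shadow (l - 1) I') \<le> card (shadow l I)"
proof -
  let ?I' = "link (Suc x) I"
  have upper: "I \<subseteq> nsets {1..Suc x} k" using subset_initial_interval[OF I le] .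
  have lower: "nsets {1..x} k \<subseteq> I" using initial_interval_subset[OF I ge] .
  have ground: "{1..Suc x} - {Suc x} = {1..x}" by auto
  have sub: "?I' \<subseteq> nsets {1..x} (k - 1)"
    using link_subset_nsets[OF upper, of "Suc x"] by (simp only: ground)
  have fin: "finite ?I'" using finite_link[OF I(2)] .
  have "del (Suc x) I \<subseteq> nsets {1..x} k"
    using del_subset_nsets[OF upper, of "Suc x"] by (simp only: ground)
  moreover have "nsets {1..x} k \<subseteq> del (Suc x) I" using lower by (auto simp: del_def nsets_def)
  ultimately have "del (Suc x) I = nsets {1..x} k" by blast
  then have card: "card I = (x choose k) + card ?I'"
    using card_link_del[OF I(2), of "Suc x"] by (simp add: card_nsets)
  have "card ?I' \<le> card (nsets {1..x} (k - 1))"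
    using sub by (intro card_mono) (auto simp: finite_imp_finite_nsets)
  then have card': "card ?I' \<le> x choose (k - 1)" by (simp add: card_nsets)
  have init: "colex_initial 1 (k - 1) ?I'"
    unfolding colex_initial_def
  proof (intro conjI ballI impI)
    have "nsets {1..x} (k - 1) \<subseteq> nsets {1..} (k - 1)" by (rule nsets_mono) auto
    then show "?I' \<subseteq> nsets {1..} (k - 1)" using sub by blast
    fix A B assume A: "A \<in> ?I'" and B: "B \<in> nsets {1..} (k - 1)" and less: "set_encode B < set_encode A"
    have A': "A \<in> nsets {1..x} (k - 1)" using A sub by blast
    \<comment> \<open>A set preceding a subset of \<open>{1..x}\<close> cannot reach beyond
      \<open>x\<close>; so \<open>Suc x\<close> is not in \<open>B\<close> and may be added.\<close>
    have B': "B \<in> nsets {1..x} (k - 1)"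
      using colex_initialD[OF colex_initial_full A' B] less by simp
    then have fins: "finite A" "finite B" "Suc x \<notin> A" "Suc x \<notin> B" using A' by (auto simp: nsets_def)
    have "insert (Suc x) B \<in> nsets {1..} k"
      using B' fins assms(3,4) by (auto simp: nsets_def)
    moreover have "insert (Suc x) A \<in> I" using A by (simp add: link_def)
    moreover have "set_encode (insert (Suc x) B) \<le> set_encode (insert (Suc x) A)" using fins less by simp
    ultimately have "insert (Suc x) B \<in> I" using colex_initialD[OF I(1)] by blast
    then show "B \<in> ?I'" using fins by (simp add: link_def)
  qed
  let ?P = "shadow (l - 1) ?I'"
  have "finite ?P" using finite_shadow[OF fin sub] .
  then have "card (insert (Suc x) ` ?P \<union> nsets {1..x} l) = card ?P + card (nsets {1..x} l)"
    by (intro card_cone) (auto simp: finite_imp_finite_nsets in_shadow_iff link_def nsets_def)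
  moreover have "insert (Suc x) ` ?P \<union> nsets {1..x} l \<subseteq> shadow l I"
    by (rule Un_least[OF insert_shadow_link_subset[OF assms(3)] nsets_subset_shadow[OF assms(4,5) lower]])
  moreover have "finite (shadow l I)" using finite_shadow[OF I(2) upper] .
  ultimately have "card ?P + card (nsets {1..x} l) \<le> card (shadow l I)" by (metis card_mono)
  then have "(x choose l) + card ?P \<le> card (shadow l I)" by (simp add: card_nsets)
  then show thesis using that init fin card card' by blast
qed

section \<open>Lower bounds for the excess of an initial segment\<close>

lemma colex_card_le_card_shadow:
  assumes "colex_initial 1 k I" "finite I" "l \<le> k" "card I \<le> (k + l) choose k"
  shows "card I \<le> card (shadow l I)"
  using subset_initial_interval[OF assms(1,2,4)] assms(3)
  by (intro card_le_card_shadow[of "{1..k + l}" I k l]) simp_all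

text \<open>Decompose at the largest \<open>x \<le> k + l - 1\<close> with
  \<open>x choose k \<le> card I\<close>. The remaining segment \<open>I'\<close> lives on
  \<open>(k - 1) + (l - 1)\<close> points, so its excess is nonnegative, and
  \<open>excess_mono\<close> passes from \<open>x\<close> down to \<open>y\<close>.\<close>

lemma excess_le_below_peak:
  assumes I: "colex_initial 1 k I" "finite I" "I \<noteq> {}" and lk: "1 \<le> l" "l < k"
    and ge: "y choose k \<le> card I"
    and le: "card I \<le> ((k + l - 1) choose k) + ((k + l - 2) choose (k - 1))"
  shows "excess k l y \<le> int (card (shadow l I)) - int (card I)"
proof -
  have pos: "1 \<le> card I" using I by (simp add: Suc_leI card_gt_0_iff)
  define p where "p = k + l - 2"
  then have p: "k + l = Suc (Suc p)" using lk by simp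
  have k1: "k = Suc (Suc (k - 2))" using lk by simp
  \<comment> \<open>Pascal's rule applied twice: the permitted size falls short of
    \<open>(k + l) choose k\<close> by the positive number
    \<open>(k + l - 2) choose (k - 2)\<close>.\<close>
  have "Suc (Suc p) choose Suc (Suc q) = (Suc p choose Suc (Suc q)) + (p choose Suc q) + (p choose q)" for q
    by simp
  from this[of "k - 2"] have top: "(k + l) choose k =
      ((k + l - 1) choose k) + ((k + l - 2) choose (k - 1)) + ((k + l - 2) choose (k - 2))"
    using k1 p by (metis diff_Suc_1 diff_Suc_Suc diff_zero numeral_2_eq_2)
  have "0 < (k + l - 2) choose (k - 2)" by simp
  then have top: "((k + l - 1) choose k) + ((k + l - 2) choose (k - 1)) < (k + l) choose k" using top by simp
  have y: "y \<le> k + l - 1"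
  proof (rule ccontr)
    assume "\<not> ?thesis"
    then have "(k + l) choose k \<le> y choose k" by (intro binomial_right_mono) simp
    then show False using top ge le by simp
  qed
  let ?P = "\<lambda>x. x \<le> k + l - 1 \<and> x choose k \<le> card I"
  define x where "x = (GREATEST x. ?P x)"
  have "?P x" unfolding x_def by (rule GreatestI_nat[of ?P y "k + l - 1"]) (use y ge in auto)
  have max: "z \<le> x" if "?P z" for z
    unfolding x_def by (rule Greatest_le_nat[of ?P z "k + l - 1"]) (use that in auto)
  have kx: "k \<le> x" using max[of k] pos lk by simp
  have yx: "y \<le> x" using max[of y] y ge by simp
  have Sx: "card I \<le> Suc x choose k"
  proof (cases "x = k + l - 1")
    case True
    then have "Suc x = k + l" using lk by simp
    then show ?thesis using top le by simp
  next
    case False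
    then show ?thesis using max[of "Suc x"] \<open>?P x\<close> by fastforce
  qed
  obtain I' where I': "colex_initial 1 (k - 1) I'" "finite I'"
    and card: "card I = (x choose k) + card I'" "card I' \<le> x choose (k - 1)"
    and sh: "(x choose l) + card (shadow (l - 1) I') \<le> card (shadow l I)"
    using colex_decompose[OF I(1,2) lk(1) _ kx _ Sx] \<open>?P x\<close> lk by (metis less_imp_le)
  \<comment> \<open>At \<open>x = k + l - 1\<close> this is exactly the assumed upper bound on
    \<open>card I\<close>; for smaller \<open>x\<close> it holds because \<open>I'\<close> lives on
    \<open>{1..x}\<close>.\<close>
  have "card I' \<le> (k + l - 2) choose (k - 1)"
  proof (cases "x = k + l - 1")
    case True
    then show ?thesis using card le by simp
  next
    case False
    then have "x choose (k - 1) \<le> (k + l - 2) choose (k - 1)"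
      using \<open>?P x\<close> False by (intro binomial_right_mono) linarith
    then show ?thesis using card by simp
  qed
  moreover have "k + l - 2 = (k - 1) + (l - 1)" using lk by simp
  ultimately have "card I' \<le> card (shadow (l - 1) I')"
    using I' lk by (intro colex_card_le_card_shadow) auto
  moreover have "excess k l y \<le> excess k l x"
    using lk yx \<open>?P x\<close> by (intro excess_mono) auto
  ultimately show ?thesis using sh card by (simp add: excess_def)
qed

text \<open>A full family gives equality of sizes, and \<open>card_shadow_deficit\<close> settles
  \<open>k + l \<le> y\<close>. Otherwise the lower bound on \<open>card I\<close> leaves only
  \<open>k + l - 2\<close> and \<open>k + l - 1\<close> for \<open>y\<close>, where
  \<open>excess k l\<close> takes the same value.\<close>

lemma excess_le_above_peak:
  assumes I: "colex_initial 1 k I" "finite I" "I \<noteq> {}" and lk: "1 \<le> l" "l < k"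
    and ge: "((k + l - 3) choose k) + ((k + l - 4) choose (k - 1)) \<le> card I"
    and le: "card I \<le> y choose k"
  shows "excess k l y \<le> int (card (shadow l I)) - int (card I)"
proof -
  have pos: "1 \<le> card I" using I by (simp add: Suc_leI card_gt_0_iff)
  have ky: "k \<le> y"
  proof (rule ccontr)
    assume "\<not> ?thesis"
    then show False using pos le by (simp add: binomial_eq_0)
  qed
  have sub: "I \<subseteq> nsets {1..y} k" using subset_initial_interval[OF I(1,2) le] .
  consider "card I = y choose k" | "k + l \<le> y" | "card I < y choose k" "y < k + l"
    using le by linarith
  then show ?thesis
  proof cases
    case 1
    then have "nsets {1..y} l \<subseteq> shadow l I"
      using I lk ky by (intro nsets_subset_shadow[of l k] initial_interval_subset) auto
    then have "card (nsets {1..y} l) \<le> card (shadow l I)"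
      using finite_shadow[OF I(2) sub] by (intro card_mono)
    then show ?thesis using 1 by (simp add: card_nsets excess_def)
  next
    case 2
    then show ?thesis
      using card_shadow_deficit[OF _ sub, of l] lk by (simp add: excess_def)
  next
    case 3
    have "k \<noteq> y" using 3 pos by auto
    then have l2: "2 \<le> l" using 3 ky by simp
    have "k + l - 2 \<le> y"
    proof (rule ccontr)
      assume "\<not> ?thesis"
      then have "y choose k \<le> (k + l - 3) choose k" by (intro binomial_right_mono) simp
      then show False using ge 3 by simp
    qed
    then consider "y = k + l - 2" | "y = Suc (k + l - 2)" using 3 by linarith
    then have y: "excess k l y = excess k l (k + l - 2)"
    proof cases
      case 2
      have "k + l - 2 = (k - 1) + (l - 1)" using lk by simp
      then show ?thesis using 2 excess_Suc[of k l "k + l - 2"] excess_eq_0[of "k - 1" "l - 1"] lk by simp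
    qed simp
    show ?thesis
    \<comment> \<open>Here a single decomposition at \<open>k + l - 2\<close> leaves a segment on
      \<open>(k - 1) + (l - 1)\<close> points.\<close>
    proof (cases "(k + l - 2) choose k \<le> card I")
      case True
      have "y choose k \<le> Suc (k + l - 2) choose k"
        using 3 l2 by (intro binomial_right_mono) simp
      then have "card I \<le> Suc (k + l - 2) choose k" using le by simp
      moreover have "k \<le> k + l - 2" using l2 by simp
      ultimately obtain I' where I': "colex_initial 1 (k - 1) I'" "finite I'"
        and card: "card I = ((k + l - 2) choose k) + card I'" "card I' \<le> (k + l - 2) choose (k - 1)"
        and sh: "((k + l - 2) choose l) + card (shadow (l - 1) I') \<le> card (shadow l I)"
        using colex_decompose[OF I(1,2) lk(1) _ _ True] lk by (metis less_imp_le)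
      have "k + l - 2 = (k - 1) + (l - 1)" using lk by simp
      then have "card I' \<le> card (shadow (l - 1) I')"
        using I' lk card by (intro colex_card_le_card_shadow) auto
      then show ?thesis using sh card y by (simp add: excess_def)
    next
      case False
      \<comment> \<open>For \<open>l = 2\<close> the binomial \<open>(k + l - 2) choose k\<close> is
        1, which a nonempty \<open>I\<close> reaches.\<close>
      have l3: "3 \<le> l"
      proof (rule ccontr)
        assume "\<not> ?thesis"
        then have "l = 2" using l2 by simp
        then show False using False pos by simp
      qed
      \<comment> \<open>The two terms of the lower bound permit decomposing at
        \<open>k + l - 3\<close> and then at \<open>k + l - 4\<close>, which leaves a segment on
        \<open>(k - 2) + (l - 2)\<close> points.\<close>
      let ?x = "k + l - 4"
      have Sx: "k + l - 3 = Suc ?x" "k + l - 2 = Suc (Suc ?x)" using l3 lk by auto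
      have "(Suc ?x) choose k \<le> card I" using ge Sx by simp
      moreover have "card I \<le> Suc (Suc ?x) choose k" using False Sx by simp
      moreover have "k \<le> Suc ?x" using l3 by simp
      ultimately obtain I' where I': "colex_initial 1 (k - 1) I'" "finite I'"
        and card: "card I = (Suc ?x choose k) + card I'" "card I' \<le> Suc ?x choose (k - 1)"
        and sh: "(Suc ?x choose l) + card (shadow (l - 1) I') \<le> card (shadow l I)"
        using colex_decompose[OF I(1,2) lk(1)] lk by (metis less_imp_le)
      have "?x choose (k - 1) \<le> card I'" using ge card Sx by simp
      moreover have "k - 1 \<le> ?x" "1 \<le> l - 1" "l - 1 \<le> k - 1" using l3 lk by auto
      ultimately obtain I'' where I'': "colex_initial 1 (k - 1 - 1) I''" "finite I''"
        and card': "card I' = (?x choose (k - 1)) + card I''" "card I'' \<le> ?x choose (k - 1 - 1)"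
        and sh': "(?x choose (l - 1)) + card (shadow (l - 1 - 1) I'') \<le> card (shadow (l - 1) I')"
        using colex_decompose[OF I' _ _ _ _ card(2)] by metis
      have x: "?x = (k - 1 - 1) + (l - 1 - 1)" using l3 lk by simp
      have "card I'' \<le> card (shadow (l - 1 - 1) I'')"
        using colex_card_le_card_shadow[OF I'', of "l - 1 - 1"] lk card'(2) unfolding x by linarith
      then have "excess k l (Suc ?x) + excess (k - 1) (l - 1) ?x \<le> int (card (shadow l I)) - int (card I)"
        using sh sh' card card' by (simp add: excess_def)
      \<comment> \<open>Nothing is lost against \<open>excess k l (k + l - 2)\<close>: in its
        expansion the third summand vanishes.\<close>
      moreover have "excess k l (Suc (Suc ?x)) = excess k l (Suc ?x) + excess (k - 1) (l - 1) (Suc ?x)"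
        using lk by (intro excess_Suc) auto
      moreover have "excess (k - 1) (l - 1) (Suc ?x) =
          excess (k - 1) (l - 1) ?x + excess (k - 1 - 1) (l - 1 - 1) ?x"
        using lk l3 by (intro excess_Suc) auto
      moreover have "excess (k - 1 - 1) (l - 1 - 1) ?x = 0" by (subst x) (rule excess_eq_0)
      ultimately show ?thesis using y Sx by simp
    qed
  qed
qed

section \<open>Cross-intersecting families\<close>

text \<open>A set is disjoint from \<open>A\<close> exactly when it lies in the complement of
  \<open>A\<close>, so \<open>\<G>\<close> avoids the shadow of the complements.\<close>

lemma cross_intersecting_card_le:
  assumes "cross_intersecting \<F> \<G>" "\<F> \<subseteq> nsets X a" "\<G> \<subseteq> nsets X b" "finite X"
  shows "card \<G> + card (shadow b ((\<lambda>A. X - A) ` \<F>)) \<le> card X choose b"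
proof -
  let ?S = "shadow b ((\<lambda>A. X - A) ` \<F>)"
  have S: "?S \<subseteq> nsets X b" by (rule shadow_subset_nsets[where k = "card X - a"])
      (use assms(2,4) in \<open>auto simp: nsets_def card_Diff_subset\<close>)
  have "\<G> \<inter> ?S = {}"
  proof (rule ccontr)
    assume "\<not> ?thesis"
    then obtain B A where "B \<in> \<G>" "A \<in> \<F>" "B \<subseteq> X - A" by (auto simp: in_shadow_iff)
    then show False using assms(1) by (auto simp: cross_intersecting_def)
  qed
  moreover have "finite \<G>" "finite ?S" using S assms(3,4) finite_family by blast+
  ultimately have "card \<G> + card ?S = card (\<G> \<union> ?S)" by (simp add: card_Un_disjoint)
  also have "\<dots> \<le> card (nsets X b)"
    using S assms(3,4) by (intro card_mono) (auto simp: finite_imp_finite_nsets)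
  finally show ?thesis using assms(4) by (simp add: card_nsets)
qed

lemma ibinom_of_nat: "ibinom (int n) (int k) = int (n choose k)"
  by (simp add: ibinom_def)

theorem theorem1:
  fixes n a b j :: nat and \<F> \<G> :: "nat set set"
  assumes "n \<ge> a + b"
    and "\<F> \<subseteq> nsets {1..n} a" and "\<G> \<subseteq> nsets {1..n} b"
    and "cross_intersecting \<F> \<G>"
    and "\<F> \<noteq> {}"
    and "j \<ge> 1"
    and "(a < b
           \<and> int (card \<F>) \<ge> ibinom (int n - int j) (int a - int j))
       \<or> (a \<ge> b
           \<and> ibinom (int n - int j) (int a - int j) \<le> int (card \<F>)
           \<and> int (card \<F>) \<le> ibinom (int n + int b - 1 - int a) (int b - 1)
                             + ibinom (int n + int b - 2 - int a) (int b - 1))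
       \<or> (a \<ge> b
           \<and> ibinom (int n - int a + int b - 3) (int b - 3)
               + ibinom (int n - int a + int b - 4) (int b - 3) \<le> int (card \<F>)
           \<and> int (card \<F>) \<le> ibinom (int n - int j) (int a - int j))"
  shows "int (card \<F>) + int (card \<G>)
           \<le> ibinom (int n) (int b) + ibinom (int n - int j) (int a - int j)
               - ibinom (int n - int j) (int b)"
proof (cases "b = 0")
  case True
  have finF: "finite \<F>" using assms(2) finite_family by blast
  then have pos: "0 < card \<F>" using assms(5) by (simp add: card_gt_0_iff)
  have "\<G> = {}"
  proof (rule ccontr)
    assume "\<G> \<noteq> {}"
    then have "{} \<in> \<G>" using assms(3) True by auto
    then show False using assms(4,5) by (auto simp: cross_intersecting_def)
  qed
  \<comment> \<open>With \<open>b = 0\<close> the first case is impossible, and the upper bound in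
    the second is zero; the third states the claim.\<close>
  moreover have "int (card \<F>) \<le> ibinom (int n - int j) (int a - int j)"
    using assms(7) pos True by (auto simp: ibinom_def split: if_splits)
  moreover have "ibinom (int n) (int b) = 1" "ibinom (int n - int j) (int b) \<le> 1"
    using True by (simp_all add: ibinom_def)
  ultimately show ?thesis by simp
next
  case False
  define k where "k = n - a"
  define y where "y = n - j"
  have l: "1 \<le> b" "b \<le> k" and n: "n = k + a" using False assms(1) by (auto simp: k_def)
  have finF: "finite \<F>" using assms(2) finite_family by blast
  let ?H = "(\<lambda>A. {1..n} - A) ` \<F>"
  have H: "?H \<subseteq> nsets {1..<Suc n} k"
    using assms(2) by (auto simp: nsets_def card_Diff_subset k_def)
  have "inj_on (\<lambda>A. {1..n} - A) \<F>"
    using assms(2) by (intro inj_onI) (auto simp: nsets_def double_diff subset_iff)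
  then have cardH: "card ?H = card \<F>" by (rule card_image)
  obtain I where I: "colex_initial 1 k I" "finite I" and cardI: "card I = card \<F>"
    using ex_colex_initial[of k 1 "card \<F>"] l by auto
  have "I \<noteq> {}" using cardI assms(5) finF by auto
  note I = I this
  have "card (shadow b I) \<le> card (shadow b ?H)"
    using kruskal_katona[OF H I(1,2)] cardI cardH l by simp
  moreover have "card \<G> + card (shadow b ?H) \<le> n choose b"
    using cross_intersecting_card_le[OF assms(4,2,3)] by simp
  ultimately have main: "card \<G> + card (shadow b I) \<le> n choose b" by linarith
  \<comment> \<open>Symmetry of the binomials, as \<open>n - a = k\<close>. For \<open>j > a\<close>
    both sides are zero, also when \<open>y\<close> is truncated to 0, since \<open>k\<close> is
    positive.\<close>
  have bin_k: "ibinom (int n - int j) (int a - int j) = int (y choose k)"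
  proof (cases "j \<le> a")
    case True
    then have "int n - int j = int (n - j)" "int a - int j = int (a - j)" using n by auto
    then have "ibinom (int n - int j) (int a - int j) = int ((n - j) choose (a - j))"
      by (simp only: ibinom_of_nat)
    also have "(n - j) choose (a - j) = y choose k"
      using True n binomial_symmetric[of "a - j" "n - j"] by (simp add: y_def)
    finally show ?thesis .
  next
    case False
    then have "y < k" using n l by (simp add: y_def)
    then show ?thesis using False by (simp add: ibinom_def binomial_eq_0)
  qed
  have bin_b: "ibinom (int n - int j) (int b) = int (y choose b)"
    using l by (auto simp: ibinom_def y_def nat_diff_distrib' binomial_eq_0)
  \<comment> \<open>By \<open>main\<close> this bound is all that remains. If \<open>b = k\<close>,
    both sides are zero.\<close>
  have "excess k b y \<le> int (card (shadow b I)) - int (card I)"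
  proof (cases "b = k")
    case True
    then show ?thesis
      using shadow_self[OF colex_initial_subset[OF I(1)]] by (simp add: excess_def)
  next
    case False
    then have lk: "b < k" using l by simp
    have low: "((k + b - 1) choose k) = (k + b - 1) choose (b - 1)"
      "((k + b - 2) choose (k - 1)) = (k + b - 2) choose (b - 1)"
      using l lk binomial_symmetric[of k "k + b - 1"] binomial_symmetric[of "k - 1" "k + b - 2"] by simp_all
    from assms(7) consider
      (1) "a < b" "y choose k \<le> card I"
    | (2) "y choose k \<le> card I" "int (card I) \<le> ibinom (int n + int b - 1 - int a) (int b - 1)
            + ibinom (int n + int b - 2 - int a) (int b - 1)"
    | (3) "ibinom (int n - int a + int b - 3) (int b - 3)
            + ibinom (int n - int a + int b - 4) (int b - 3) \<le> int (card I)"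
          "card I \<le> y choose k"
      unfolding bin_k cardI by auto
    then show ?thesis
    proof cases
      case 1
      have "card I \<le> card (nsets {1..<Suc n} k)"
        unfolding cardI cardH[symmetric] using H by (intro card_mono finite_imp_finite_nsets) auto
      also have "\<dots> = n choose k" by (simp add: card_nsets)
      \<comment> \<open>From \<open>a < b\<close> follows \<open>n = k + a \<le> k + b - 1\<close>,
        so the size bound below the peak is automatic.\<close>
      also have "\<dots> \<le> (k + b - 1) choose k" using 1 n by (intro binomial_right_mono) simp
      finally show ?thesis using excess_le_below_peak[OF I l(1) lk 1(2)] by simp
    next
      case 2
      have "int n + int b - 1 - int a = int (k + b - 1)" "int n + int b - 2 - int a = int (k + b - 2)"
        "int b - 1 = int (b - 1)"
        using n l lk by auto
      then have "card I \<le> ((k + b - 1) choose k) + ((k + b - 2) choose (k - 1))"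
        using 2(2) unfolding low by (simp only: ibinom_of_nat)
      then show ?thesis using excess_le_below_peak[OF I l(1) lk 2(1)] by simp
    next
      case 3
      have "((k + b - 3) choose k) + ((k + b - 4) choose (k - 1)) \<le> card I"
      proof (cases "3 \<le> b")
        case True
        have "int n - int a + int b - 3 = int (k + b - 3)" "int n - int a + int b - 4 = int (k + b - 4)"
          "int b - 3 = int (b - 3)"
          using n True lk by auto
        moreover have "(k + b - 3) choose k = (k + b - 3) choose (b - 3)"
          "(k + b - 4) choose (k - 1) = (k + b - 4) choose (b - 3)"
          using True lk binomial_symmetric[of k "k + b - 3"] binomial_symmetric[of "k - 1" "k + b - 4"]
          by simp_all
        ultimately show ?thesis using 3(1) by (simp only: ibinom_of_nat)
      next
        case False
        \<comment> \<open>For \<open>b < 3\<close> both binomials of the required lower bound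
          vanish.\<close>
        then have "k + b - 3 < k" "k + b - 4 < k - 1" using l lk by auto
        then show ?thesis by (simp add: binomial_eq_0)
      qed
      then show ?thesis using excess_le_above_peak[OF I l(1) lk _ 3(2)] by simp
    qed
  qed
  then show ?thesis
    using main cardI unfolding bin_k bin_b ibinom_of_nat excess_def by linarith
qed

end
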